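(* Let $N\in\mathbb{N}$ and let $A=[a_1\cdots a_N]$ be a real $N\times N$ matrix with columns $a_1,\ldots,a_N$ and with $\|A\|\leq 1$. If $\theta=\min_{1\leq i\leq N}\|a_i\|>0$, then for every $n\in\mathbb{N}$ with $1\leq n\leq \frac{1}{5}\theta^{4/3}N^{1/3}$ there exist a real $n\times N$ matrix $L$ and a real $N\times n$ matrix $R$ such that $LAR=I_n$ and $\|L\|\|R\|\leq 2/\theta$.
   Context: $\mathbb{N}=\{1,2,\ldots\}$. For a vector $x\in\mathbb{R}^k$, $\|x\|$ is the Euclidean norm. For a real $m\times k$ matrix $B$, $\|B\|=\sup\{\|Bx\|:x\in\mathbb{R}^k,\ \|x\|\leq 1\}$ is the Euclidean operator norm. $I_n$ is the $n\times n$ identity matrix. *)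

theory Defs
  imports "HOL-Analysis.Analysis"
begin

text \<open>
  The Euclidean operator norm of a matrix \<open>B\<close> is \<open>onorm ((*v) B)\<close>. The library defines
  \<open>onorm\<close> as a supremum of quotients; it is also the supremum over the closed unit ball.
\<close>

lemma onorm_matrix_eq_Sup_unit_ball:
  fixes B :: "real^'k^'m"
  shows "onorm ((*v) B) = (SUP x\<in>{x. norm x \<le> 1}. norm (B *v x))"
proof (rule antisym)
  have bl: "bounded_linear ((*v) B)"
    by (rule matrix_vector_mul_bounded_linear)
  have le: "norm (B *v x) \<le> onorm ((*v) B)" if "norm x \<le> 1" for x
  proof -
    have "norm (B *v x) \<le> onorm ((*v) B) * norm x"
      by (rule onorm[OF bl])
    also have "\<dots> \<le> onorm ((*v) B) * 1"
      by (rule mult_left_mono[OF that onorm_pos_le[OF bl]])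
    finally show ?thesis by simp
  qed
  have bdd: "bdd_above ((\<lambda>x. norm (B *v x)) ` {x. norm x \<le> 1})"
    using le by (intro bdd_aboveI2) auto
  show "onorm ((*v) B) \<le> (SUP x\<in>{x. norm x \<le> 1}. norm (B *v x))"
    unfolding onorm_def
  proof (rule cSUP_least)
    fix x :: "real^'k"
    have "norm (B *v x) / norm x = norm (B *v (x /\<^sub>R norm x))"
      by (simp add: matrix_vector_mult_scaleR divide_inverse mult.commute)
    also have "\<dots> \<le> (SUP x\<in>{x. norm x \<le> 1}. norm (B *v x))"
      by (rule cSUP_upper[OF _ bdd]) (cases "x = 0"; simp)
    finally show "norm (B *v x) / norm x \<le> (SUP x\<in>{x. norm x \<le> 1}. norm (B *v x))" .
  qed simp
  show "(SUP x\<in>{x. norm x \<le> 1}. norm (B *v x)) \<le> onorm ((*v) B)"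
    using le by (intro cSUP_least) (auto intro: exI[of _ 0])
qed

end

theory Submission
  imports Defs
begin

text \<open>
  Since \<open>\<parallel>A\<^sup>T a\<^sub>i\<parallel> \<le> 1\<close>, each column \<open>a\<^sub>i\<close> has at most \<open>1 / \<delta>\<^sup>2\<close> columns \<open>a\<^sub>j\<close> with
  \<open>\<bar>\<langle>a\<^sub>i, a\<^sub>j\<rangle>\<bar> \<ge> \<delta>\<close>. A greedy choice therefore yields \<open>n\<close> columns with pairwise inner products
  below \<open>\<delta> = 3\<theta>\<^sup>2 / (4n)\<close>, because \<open>n / \<delta>\<^sup>2 < N\<close>. Their Gram matrix is diagonally dominant, so the
  selected submatrix \<open>M = AR\<close> satisfies \<open>\<parallel>Mx\<parallel> \<ge> \<theta>/2 \<parallel>x\<parallel>\<close>, and its Moore--Penrose left inverse has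
  norm at most \<open>2/\<theta>\<close>.
\<close>

lemma norm_transpose_mult_le:
  fixes A :: "real^'n^'m"
  assumes "onorm ((*v) A) \<le> 1"
  shows "norm (transpose A *v y) \<le> norm y"
proof -
  let ?z = "transpose A *v y"
  have "norm (A *v ?z) \<le> onorm ((*v) A) * norm ?z"
    by (rule onorm) (rule matrix_vector_mul_bounded_linear)
  also have "\<dots> \<le> norm ?z"
    using mult_right_mono[OF assms, of "norm ?z"] by simp
  finally have Az: "norm (A *v ?z) \<le> norm ?z" .
  \<comment> \<open>Moving the transpose across the inner product bounds the square of
    \<open>norm ?z\<close> by \<open>norm y * norm ?z\<close>; one factor then cancels.\<close>
  have "norm ?z * norm ?z = y \<bullet> (A *v ?z)"
    by (metis dot_lmul_matrix norm_eq_sqrt_inner real_sqrt_mult_self abs_of_nonneg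
        inner_ge_zero transpose_matrix_vector)
  also have "\<dots> \<le> norm y * norm (A *v ?z)"
    by (rule norm_cauchy_schwarz)
  also have "\<dots> \<le> norm y * norm ?z"
    by (rule mult_left_mono[OF Az]) simp
  finally show ?thesis
    by (cases "norm ?z = 0") (auto simp: mult_le_cancel_right)
qed

lemma norm_column_le_onorm:
  fixes A :: "real^'n^'m"
  shows "norm (column i A) \<le> onorm ((*v) A)"
  using onorm[OF matrix_vector_mul_bounded_linear, of A "axis i 1"]
  by (simp add: matrix_vector_mult_basis)

text \<open>The summed inner products are the coordinates of
  \<open>transpose A *v column i A\<close>, whose norm is at most that of the column, hence at most
  1.\<close>

lemma sum_inner_columns_squared_le_1:
  fixes A :: "real^'n^'m"
  assumes "onorm ((*v) A) \<le> 1"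
  shows "(\<Sum>j\<in>UNIV. (column i A \<bullet> column j A)\<^sup>2) \<le> 1"
proof -
  let ?z = "transpose A *v column i A"
  have "?z $ j = column i A \<bullet> column j A" for j
    by (simp add: matrix_vector_mult_def transpose_def inner_vec_def column_def mult.commute)
  then have "(\<Sum>j\<in>UNIV. (column i A \<bullet> column j A)\<^sup>2) = (norm ?z)\<^sup>2"
    unfolding power2_norm_eq_inner inner_vec_def[of ?z] by (simp add: power2_eq_square)
  also have "\<dots> \<le> 1"
    using norm_transpose_mult_le[OF assms, of "column i A"] norm_column_le_onorm[of i A] assms
    by (simp add: power_le_one)
  finally show ?thesis .
qed

text \<open>Chebyshev's counting argument: each counted index contributes at least
  \<open>\<delta>\<^sup>2\<close> to a sum of squares that is at most 1.\<close>

lemma card_large_inner_columns: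
  fixes A :: "real^'n^'m"
  assumes "onorm ((*v) A) \<le> 1" and "0 < \<delta>"
  shows "real (card {j. \<delta> \<le> \<bar>column i A \<bullet> column j A\<bar>}) \<le> 1 / \<delta>\<^sup>2"
proof -
  let ?B = "{j. \<delta> \<le> \<bar>column i A \<bullet> column j A\<bar>}"
  have "real (card ?B) * \<delta>\<^sup>2 = (\<Sum>j\<in>?B. \<delta>\<^sup>2)"
    by simp
  also have "\<dots> \<le> (\<Sum>j\<in>?B. (column i A \<bullet> column j A)\<^sup>2)"
    using assms(2) by (intro sum_mono) (auto simp: power2_le_iff_abs_le abs_le_square_iff[symmetric])
  also have "\<dots> \<le> (\<Sum>j\<in>UNIV. (column i A \<bullet> column j A)\<^sup>2)"
    by (rule sum_mono2) auto
  also have "\<dots> \<le> 1"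
    by (rule sum_inner_columns_squared_le_1[OF assms(1)])
  finally show ?thesis
    using assms(2) by (simp add: field_simps)
qed

text \<open>With \<open>P\<close> read as adjacency in a graph with loops, the neighbourhoods of
  \<open>n\<close> chosen vertices cover at most \<open>n * d\<close> vertices, so a vertex outside
  all of them can be added.\<close>

lemma greedy_independent_set:
  fixes P :: "'a::finite \<Rightarrow> 'a \<Rightarrow> bool"
  assumes sym: "\<And>i j. P i j \<Longrightarrow> P j i"
    and refl: "\<And>i. P i i"
    and deg: "\<And>i. real (card {j. P i j}) \<le> d"
    and "real n * d < real CARD('a)"
  shows "\<exists>S. card S = n \<and> (\<forall>i\<in>S. \<forall>j\<in>S. i \<noteq> j \<longrightarrow> \<not> P i j)"
  using assms(4)
proof (induction n)
  case 0
  show ?case by (rule exI[of _ "{}"]) simp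
next
  case (Suc n)
  \<comment> \<open>This lets the size bound pass from \<open>Suc n\<close> down to
    \<open>n\<close>; \<open>undefined\<close> stands for an arbitrary vertex.\<close>
  have "0 \<le> d"
    using deg[of undefined] by (rule order_trans[rotated]) simp
  then have n: "real n * d < real CARD('a)"
    using Suc.prems by (simp add: algebra_simps)
  then obtain S where S: "card S = n" "\<forall>i\<in>S. \<forall>j\<in>S. i \<noteq> j \<longrightarrow> \<not> P i j"
    using Suc.IH by blast
  have "real (card (\<Union>i\<in>S. {j. P i j})) \<le> (\<Sum>i\<in>S. real (card {j. P i j}))"
    unfolding of_nat_sum[symmetric] of_nat_le_iff by (rule card_UN_le) simp
  also have "\<dots> \<le> real n * d"
    using sum_mono[of S "\<lambda>i. real (card {j. P i j})" "\<lambda>_. d"] deg S(1) by simp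
  finally have "(\<Union>i\<in>S. {j. P i j}) \<noteq> UNIV"
    using n by (metis not_le)
  then obtain k where k: "\<And>i. i \<in> S \<Longrightarrow> \<not> P i k"
    by blast
  \<comment> \<open>The loop at \<open>k\<close> excludes it from \<open>S\<close>, so inserting it
    really raises the cardinality.\<close>
  then have "k \<notin> S"
    using refl by blast
  then show ?case
    using S k sym by (intro exI[of _ "insert k S"]) auto
qed

lemma sum_abs_squared_le:
  fixes x :: "real^'n"
  shows "(\<Sum>i\<in>UNIV. \<bar>x $ i\<bar>)\<^sup>2 \<le> real CARD('n) * (norm x)\<^sup>2"
  unfolding power2_norm_eq_inner inner_vec_def
  using Cauchy_Schwarz_ineq_sum[of "\<lambda>_. 1" "\<lambda>i. \<bar>x $ i\<bar>" UNIV]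
  by (simp add: power2_eq_square)

text \<open>Diagonal dominance of the Gram matrix: the off-diagonal terms cost at most \<delta>
  times the squared sum of the \<open>\<bar>x $ i\<bar>\<close>, which Cauchy-Schwarz
  controls.\<close>

lemma norm_matrix_mult_ge_of_almost_orthogonal:
  fixes M :: "real^'n^'m"
  assumes diag: "\<And>i. \<theta>\<^sup>2 \<le> (norm (column i M))\<^sup>2"
    and off: "\<And>i j. i \<noteq> j \<Longrightarrow> \<bar>column i M \<bullet> column j M\<bar> \<le> \<delta>"
    and "0 \<le> \<delta>"
  shows "(\<theta>\<^sup>2 - real CARD('n) * \<delta>) * (norm x)\<^sup>2 \<le> (norm (M *v x))\<^sup>2"
proof -
  have Mx: "M *v x = (\<Sum>i\<in>UNIV. x $ i *\<^sub>R column i M)"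
    by (simp add: matrix_mult_sum scalar_mult_eq_scaleR)
  \<comment> \<open>Subtracting the \<delta> term on the diagonal as well lets the double sum of
    these terms factor as a square.\<close>
  have entry: "(if i = j then \<theta>\<^sup>2 * (x $ i)\<^sup>2 else 0) - \<delta> * (\<bar>x $ i\<bar> * \<bar>x $ j\<bar>)
      \<le> x $ i * (x $ j * (column i M \<bullet> column j M))" for i j
  proof (cases "i = j")
    case True
    have "\<theta>\<^sup>2 * (x $ i)\<^sup>2 \<le> (norm (column i M))\<^sup>2 * (x $ i)\<^sup>2"
      by (rule mult_right_mono[OF diag]) simp
    moreover have "0 \<le> \<delta> * (\<bar>x $ i\<bar> * \<bar>x $ i\<bar>)"
      using \<open>0 \<le> \<delta>\<close> by simp
    ultimately show ?thesis
      using True unfolding power2_norm_eq_inner by (simp add: power2_eq_square algebra_simps)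
  next
    case False
    have "\<bar>x $ i * (x $ j * (column i M \<bullet> column j M))\<bar>
        = \<bar>column i M \<bullet> column j M\<bar> * (\<bar>x $ i\<bar> * \<bar>x $ j\<bar>)"
      by (simp add: abs_mult)
    also have "\<dots> \<le> \<delta> * (\<bar>x $ i\<bar> * \<bar>x $ j\<bar>)"
      by (rule mult_right_mono[OF off[OF False]]) simp
    finally show ?thesis
      using False by simp
  qed
  have "(\<theta>\<^sup>2 - real CARD('n) * \<delta>) * (norm x)\<^sup>2
      \<le> \<theta>\<^sup>2 * (norm x)\<^sup>2 - \<delta> * (\<Sum>i\<in>UNIV. \<bar>x $ i\<bar>)\<^sup>2"
    using mult_left_mono[OF sum_abs_squared_le[of x] \<open>0 \<le> \<delta>\<close>] by (simp add: algebra_simps)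
  also have "\<dots> = (\<Sum>i\<in>UNIV. \<Sum>j\<in>UNIV.
      (if i = j then \<theta>\<^sup>2 * (x $ i)\<^sup>2 else 0) - \<delta> * (\<bar>x $ i\<bar> * \<bar>x $ j\<bar>))"
    unfolding power2_norm_eq_inner inner_vec_def power2_eq_square[of "sum _ _"] sum_product
    by (simp add: sum_subtractf power2_eq_square sum_distrib_left)
  also have "\<dots> \<le> (\<Sum>i\<in>UNIV. \<Sum>j\<in>UNIV. x $ i * (x $ j * (column i M \<bullet> column j M)))"
    by (intro sum_mono entry)
  also have "\<dots> = (norm (M *v x))\<^sup>2"
    unfolding power2_norm_eq_inner Mx
    by (simp add: inner_sum_left inner_sum_right sum_distrib_left inner_commute mult.left_commute)
  finally show ?thesis .
qed

text \<open>For the Moore-Penrose inverse \<open>L\<close>, \<open>M ** L\<close> is the orthogonal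
  projection onto the range of \<open>M\<close>, so \<open>c * norm (L *v y)\<close> is at most
  \<open>norm y\<close>.\<close>

lemma left_inverse_bounded:
  fixes M :: "real^'n^'m"
  assumes "0 < c" and lower: "\<And>x. c * norm x \<le> norm (M *v x)"
  shows "\<exists>L :: real^'m^'n. L ** M = mat 1 \<and> onorm ((*v) L) \<le> 1 / c"
proof -
  define G where "G = transpose M ** M"
  have G_inner: "x \<bullet> (G *v x) = (norm (M *v x))\<^sup>2" for x
    unfolding G_def power2_norm_eq_inner
    by (metis dot_lmul_matrix inner_commute matrix_vector_mul_assoc transpose_matrix_vector)
  have "x = 0" if "G *v x = 0" for x
    using G_inner[of x] that lower[of x] \<open>0 < c\<close> by (simp add: mult_le_0_iff)
  then obtain H where H: "H ** G = mat 1"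
    using matrix_left_invertible_ker[of G] by blast
  then have GH: "G ** H = mat 1"
    by (simp add: matrix_left_right_inverse)
  define L where "L = H ** transpose M"
  have "norm (L *v y) \<le> 1 / c * norm y" for y
  proof -
    let ?z = "L *v y"
    \<comment> \<open>These are the normal equations: \<open>y - M *v ?z\<close> is orthogonal to
      the range of \<open>M\<close>.\<close>
    have "G *v ?z = transpose M *v y"
      by (simp add: L_def matrix_vector_mul_assoc matrix_mul_assoc GH)
    then have "(norm (M *v ?z))\<^sup>2 = ?z \<bullet> (transpose M *v y)"
      by (simp flip: G_inner)
    also have "\<dots> = (M *v ?z) \<bullet> y"
      by (metis dot_lmul_matrix inner_commute transpose_matrix_vector)
    also have "\<dots> \<le> norm (M *v ?z) * norm y"
      by (rule norm_cauchy_schwarz)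
    finally have "norm (M *v ?z) \<le> norm y"
      by (cases "norm (M *v ?z) = 0") (auto simp: power2_eq_square mult_le_cancel_left)
    with lower[of ?z] show ?thesis
      using \<open>0 < c\<close> by (simp add: field_simps)
  qed
  then have "onorm ((*v) L) \<le> 1 / c"
    by (rule onorm_le)
  moreover have "L ** M = mat 1"
    using H by (simp add: L_def G_def matrix_mul_assoc)
  ultimately show ?thesis by blast
qed

theorem theorem2p10:
  fixes A :: "real^'N^'N"
    and \<theta> :: real
  assumes "onorm ((*v) A) \<le> 1"
    and "\<theta> = (MIN i. norm (column i A))"
    and "\<theta> > 0"
    and "real CARD('n::finite) \<le> 1 / 5 * \<theta> powr (4 / 3) * real CARD('N) powr (1 / 3)"
  shows "\<exists>(L :: real^'N^'n) (R :: real^'n^'N).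
           L ** A ** R = mat 1 \<and> onorm ((*v) L) * onorm ((*v) R) \<le> 2 / \<theta>"
proof -
  define n where "n = real CARD('n)"
  \<comment> \<open>The factor 3/4 leaves
    \<open>\<theta>\<^sup>2 - n * \<delta> = (\<theta> / 2)\<^sup>2\<close>, the lower bound needed
    for a left inverse of norm at most \<open>2 / \<theta>\<close>.\<close>
  define \<delta> where "\<delta> = 3 * \<theta>\<^sup>2 / (4 * n)"
  have "CARD('n) \<ge> 1"
    by (simp add: Suc_le_eq)
  then have n1: "1 \<le> n"
    unfolding n_def by linarith
  have \<delta>: "0 < \<delta>" "\<delta> \<le> \<theta>\<^sup>2" "n * \<delta> = 3 / 4 * \<theta>\<^sup>2"
    using n1 \<open>\<theta> > 0\<close> by (auto simp: \<delta>_def field_simps intro: mult_mono)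
  have \<theta>: "\<theta> \<le> norm (column i A)" for i
    unfolding assms(2) by (rule Min_le) auto
  have "n ^ 3 \<le> (1 / 5 * \<theta> powr (4 / 3) * real CARD('N) powr (1 / 3)) ^ 3"
    using assms(4) by (intro power_mono) (auto simp: n_def)
  also have "\<dots> = \<theta> ^ 4 * real CARD('N) / 125"
    using \<open>\<theta> > 0\<close> by (simp add: power_mult_distrib powr_power field_simps)
  finally have n3: "125 * n ^ 3 \<le> \<theta> ^ 4 * real CARD('N)"
    by simp
  \<comment> \<open>Since \<open>1 / \<delta>\<^sup>2 = 16 * n\<^sup>2 / (9 * \<theta> ^ 4)\<close>,
    this is the counting condition of the greedy choice with denominators cleared.\<close>
  have "16 * n ^ 3 < 9 * (\<theta> ^ 4 * real CARD('N))"
    using n3 zero_less_power[of n 3] n1 by linarith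
  then have many: "n * (1 / \<delta>\<^sup>2) < real CARD('N)"
    using n1 \<open>\<theta> > 0\<close>
    by (simp add: \<delta>_def field_simps power2_eq_square power3_eq_cube power4_eq_xxxx)
  have "\<exists>S. card S = CARD('n) \<and>
      (\<forall>i\<in>S. \<forall>j\<in>S. i \<noteq> j \<longrightarrow> \<not> \<delta> \<le> \<bar>column i A \<bullet> column j A\<bar>)"
  proof (rule greedy_independent_set)
    fix i
    have "\<theta>\<^sup>2 \<le> (norm (column i A))\<^sup>2"
      using \<theta> \<open>\<theta> > 0\<close> by (intro power_mono) auto
    then show "\<delta> \<le> \<bar>column i A \<bullet> column i A\<bar>"
      using \<delta>(2) by (simp add: power2_norm_eq_inner)
  qed (use many card_large_inner_columns[OF assms(1) \<delta>(1)] in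
      \<open>auto simp: inner_commute n_def\<close>)
  then obtain S where S: "card S = CARD('n)"
    and small: "\<And>i j. \<lbrakk>i \<in> S; j \<in> S; i \<noteq> j\<rbrakk> \<Longrightarrow> \<bar>column i A \<bullet> column j A\<bar> < \<delta>"
    by force
  obtain f :: "'n \<Rightarrow> 'N" where "bij_betw f UNIV S"
    using finite_same_card_bij[of "UNIV :: 'n set" S] S by auto
  then have f: "inj f" "\<And>i. f i \<in> S"
    by (auto simp: bij_betw_def)
  \<comment> \<open>The columns of \<open>R\<close> are distinct standard basis vectors, so
    \<open>A ** R\<close> selects the columns indexed by \<open>S\<close> and \<open>R\<close> is an
    isometry.\<close>
  define R :: "real^'n^'N" where "R = (\<chi> i j. if i = f j then 1 else 0)"
  define M where "M = A ** R"
  have col: "column j M = column (f j) A" for j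
    by (simp add: M_def R_def vec_eq_iff column_def matrix_matrix_mult_def if_distrib cong: if_cong)
  have "(\<Sum>k\<in>UNIV. R $ k $ i * R $ k $ j) =
      (\<Sum>k\<in>UNIV. if k = f i then R $ k $ j else 0)" for i j
    by (rule sum.cong) (auto simp: R_def)
  then have "transpose R ** R = mat 1"
    using f(1) by (simp add: vec_eq_iff transpose_def matrix_matrix_mult_def mat_def)
      (simp add: R_def inj_eq)
  then have "(norm (R *v x))\<^sup>2 = (norm x)\<^sup>2" for x
    unfolding power2_norm_eq_inner
    by (metis dot_lmul_matrix matrix_vector_mul_assoc matrix_vector_mul_lid transpose_matrix_vector)
  then have R: "onorm ((*v) R) \<le> 1"
    by (intro onorm_le) (simp add: power2_eq_iff_nonneg)
  have "\<theta> / 2 * norm x \<le> norm (M *v x)" for x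
  proof (rule power2_le_imp_le)
    have "(\<theta>\<^sup>2 - n * \<delta>) * (norm x)\<^sup>2 \<le> (norm (M *v x))\<^sup>2"
      unfolding n_def
    proof (rule norm_matrix_mult_ge_of_almost_orthogonal)
      fix i j :: 'n
      show "\<theta>\<^sup>2 \<le> (norm (column i M))\<^sup>2"
        unfolding col using \<theta> \<open>\<theta> > 0\<close> by (intro power_mono) auto
      show "\<bar>column i M \<bullet> column j M\<bar> \<le> \<delta>" if "i \<noteq> j"
        unfolding col using small[of "f i" "f j"] f that by (auto simp: inj_eq)
    qed (use \<delta> in simp)
    then show "(\<theta> / 2 * norm x)\<^sup>2 \<le> (norm (M *v x))\<^sup>2"
      by (simp add: \<delta>(3) power_mult_distrib power_divide)
  qed simp
  then obtain L where L: "L ** M = mat 1" "onorm ((*v) L) \<le> 1 / (\<theta> / 2)"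
    using left_inverse_bounded[of "\<theta> / 2" M] \<open>\<theta> > 0\<close> by auto
  have "onorm ((*v) L) * onorm ((*v) R) \<le> 2 / \<theta> * 1"
    using L(2) R \<open>\<theta> > 0\<close> by (intro mult_mono onorm_pos_le matrix_vector_mul_bounded_linear) auto
  then show ?thesis
    using L(1) by (auto simp: M_def matrix_mul_assoc)
qed

end
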